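(* Let $n\in\mathbb{N}$, $\delta\in(0,1)$ and $m = n(1-\delta)$. In any open-addressing scheme that does not perform reordering and inserts $m$ keys into an array of $n$ slots, with probability greater than $1/2$ there is some key whose probe complexity is $\Omega(\log^2\delta^{-1})$. In other words, $\Pr[Y_i \le c \text{ for all } i\in[m]] \le 1/2$ for all $c \in o(\log^2 \delta^{-1})$, where $Y_i$ is the probe complexity of the $i$-th inserted key.
   Context: An open-addressing scheme without reordering with capacity $n$: an array of $n$ slots indexed by $[n]$, initially empty; keys $k_1,\dots,k_m$ are inserted one after another; each key $k_i$ has an infinite probe sequence $H_1(k_i),H_2(k_i),\dots\in[n]^\infty$, and these probe sequences are i.i.d. across keys. To insert $k_i$, an (arbitrary, not necessarily greedy) insertion algorithm places $k_i$ into some currently unoccupied slot $H_j(k_i)$; placed elements are never moved. The probe complexity of $k_i$ is $Y_i$, the index $j$ such that $k_i$ is placed in slot $H_j(k_i)$. $\log$ is base 2. *)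

theory Defs
  imports "HOL-Probability.Probability" "HOL-Library.Landau_Symbols"
begin

text \<open>
  Keys, probes and slots are numbered from 1. A probe sequence is an element of \<open>[n]\<^sup>\<infinity>\<close>,
  represented as an extensional function on \<open>{1..}\<close>.
\<close>

definition probe_seqs :: "nat \<Rightarrow> (nat \<Rightarrow> nat) measure" where
  "probe_seqs n = (\<Pi>\<^sub>M j\<in>{1..}. count_space {1..n})"

text \<open>
  A run is a pair \<open>(r, h)\<close> of the random seed \<open>r\<close> of the insertion algorithm and the probe sequences
  \<open>h 1, \<dots>, h m\<close> of the keys, which are drawn independently of each other and of the seed, each
  from the law \<open>D\<close>.
\<close>

definition runs :: "nat \<Rightarrow> (nat \<Rightarrow> nat) measure \<Rightarrow> real measure \<Rightarrow> (real \<times> (nat \<Rightarrow> nat \<Rightarrow> nat)) measure"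
  where "runs m D R = R \<Otimes>\<^sub>M (\<Pi>\<^sub>M i\<in>{1..m}. D)"

text \<open>
  \<open>A i\<close> chooses the probe index for the \<open>i\<close>-th key. The algorithm is online: it only sees its seed and
  the probe sequences of the first \<open>i\<close> keys. These determine the current contents of the array, so
  the array is not passed separately.
\<close>

definition probe_complexity ::
  "(nat \<Rightarrow> real \<times> (nat \<Rightarrow> nat \<Rightarrow> nat) \<Rightarrow> nat) \<Rightarrow> nat \<Rightarrow> real \<times> (nat \<Rightarrow> nat \<Rightarrow> nat) \<Rightarrow> nat" where
  "probe_complexity A i \<omega> = A i (fst \<omega>, restrict (snd \<omega>) {1..i})"

definition slot ::
  "(nat \<Rightarrow> real \<times> (nat \<Rightarrow> nat \<Rightarrow> nat) \<Rightarrow> nat) \<Rightarrow> nat \<Rightarrow> real \<times> (nat \<Rightarrow> nat \<Rightarrow> nat) \<Rightarrow> nat" where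
  "slot A i \<omega> = snd \<omega> i (probe_complexity A i \<omega>)"

text \<open>
  An open-addressing scheme without reordering that inserts \<open>m\<close> keys into \<open>n\<close> slots. The law \<open>D\<close> of the
  probe sequences is arbitrary (probes need be neither uniform nor independent within one sequence).
  Placed keys never move, so the slots occupied when key \<open>i\<close> arrives are those of the keys
  \<open>1, \<dots>, i - 1\<close>. Placement is required to succeed almost surely only: under uniform probing,
  for instance, a probe sequence misses all free slots with probability 0, but not never.
\<close>

locale open_addressing =
  fixes n m :: nat
    and D :: "(nat \<Rightarrow> nat) measure"
    and R :: "real measure"
    and A :: "nat \<Rightarrow> real \<times> (nat \<Rightarrow> nat \<Rightarrow> nat) \<Rightarrow> nat"
  assumes prob_space_D: "prob_space D"
    and sets_D: "sets D = sets (probe_seqs n)"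
    and prob_space_R: "prob_space R"
    and sets_R: "sets R = sets borel"
    and measurable_A: "\<And>i. i \<in> {1..m} \<Longrightarrow>
      A i \<in> measurable (R \<Otimes>\<^sub>M (\<Pi>\<^sub>M k\<in>{1..i}. D)) (count_space UNIV)"
    and placed: "AE \<omega> in runs m D R. \<forall>i\<in>{1..m}.
      1 \<le> probe_complexity A i \<omega> \<and> (\<forall>k\<in>{1..<i}. slot A i \<omega> \<noteq> slot A k \<omega>)"

end

theory Submission
  imports Defs
begin

text \<open>
  Let \<open>q s\<close> be the probability that slot \<open>s\<close> is among the first \<open>c\<close> probes of a key, so that the \<open>q s\<close>
  sum to at most \<open>c\<close>, and let \<open>l = ln (1 / \<delta>)\<close>. Fix \<open>t\<close> between \<open>\<delta>\<^bsup>1/4\<^esup> n\<close> and \<open>n / 2\<close>, and call \<open>s\<close> light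
  if \<open>q s < l / (16 t)\<close>. If fewer than \<open>t / 2\<close> slots are not light, then at least \<open>t / 2\<close> light slots are
  free before the last \<open>t\<close> insertions, and they do not depend on the last \<open>t\<close> probe sequences. The last
  \<open>t\<close> keys miss at least \<open>\<delta>\<^bsup>1/8\<^esup> t / 2\<close> of them in expectation, with variance at most \<open>t c\<^sup>2\<close>, whereas only
  \<open>\<delta> n\<close> slots may remain free; Chebyshev's inequality bounds the probability of success. So if success is
  likely, at least \<open>t / 2\<close> slots satisfy \<open>q s \<ge> l / (16 t)\<close> for every such \<open>t\<close>. Each of the \<open>\<Omega>(l)\<close> powers
  of 2 in that range therefore contributes \<open>\<Omega>(l)\<close> to the sum of the \<open>q s\<close>, whence \<open>c = \<Omega>(l\<^sup>2)\<close>.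
\<close>

section \<open>Charging over dyadic levels\<close>

text \<open>The contributing indices all lie at or above the least one, \<open>i0\<close>, and the
  full geometric series from \<open>i0\<close> on sums to at most \<open>a / 2 ^ i0\<close>, which
  is at most \<open>q\<close>.\<close>

lemma sum_dyadic_le:
  fixes a q :: real
  assumes "finite I" "0 \<le> a" "0 \<le> q"
  shows "(\<Sum>i\<in>{i\<in>I. a / 2 ^ i \<le> q}. a / 2 ^ Suc i) \<le> q"
proof (cases "{i\<in>I. a / 2 ^ i \<le> q} = {}")
  case True
  show ?thesis unfolding True using assms by simp
next
  case False
  let ?I = "{i\<in>I. a / 2 ^ i \<le> q}"
  have fin: "finite ?I" using assms by simp
  define i0 where "i0 = Min ?I"
  have i0: "i0 \<in> ?I" unfolding i0_def using fin False by (rule Min_in)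
  have tele: "(\<Sum>i\<in>{i0..<i0+k}. a / 2 ^ Suc i) = a / 2 ^ i0 - a / 2 ^ (i0 + k)" for k
  proof (induction k)
    case (Suc k)
    have "a / 2 ^ (i0 + k) = 2 * (a / 2 ^ Suc (i0 + k))" by simp
    then show ?case using Suc by simp
  qed simp
  \<comment> \<open>The upper end overshoots \<open>Max ?I\<close> so that the interval has the form
    summed by \<open>tele\<close>.\<close>
  have "?I \<subseteq> {i0..<i0 + Suc (Max ?I)}"
    unfolding i0_def using Min_le[OF fin] Max_ge[OF fin] by (force simp: less_Suc_eq_le trans_le_add2)
  then have "(\<Sum>i\<in>?I. a / 2 ^ Suc i) \<le> (\<Sum>i\<in>{i0..<i0 + Suc (Max ?I)}. a / 2 ^ Suc i)"
    using assms by (intro sum_mono2) auto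
  also have "\<dots> \<le> a / 2 ^ i0" unfolding tele using assms by simp
  also have "\<dots> \<le> q" using i0 by simp
  finally show ?thesis .
qed

text \<open>Level \<open>i\<close> charges \<open>a / 2 ^ Suc i\<close> to each of its at least
  \<open>2 ^ i / 2\<close> members, hence at least \<open>a / 4\<close> in all. Swapping the sums,
  \<open>sum_dyadic_le\<close> shows that no \<open>s\<close> is charged more than
  \<open>q s\<close>, although it may belong to many levels.\<close>

lemma dyadic_levels_sum_ge:
  fixes a :: real and q :: "'s \<Rightarrow> real"
  assumes "finite S" "finite I" "0 \<le> a" "\<And>s. s \<in> S \<Longrightarrow> 0 \<le> q s"
    and levels: "\<And>i. i \<in> I \<Longrightarrow> 2 ^ i / 2 \<le> real (card {s\<in>S. a / 2 ^ i \<le> q s})"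
  shows "a * real (card I) / 4 \<le> (\<Sum>s\<in>S. q s)"
proof -
  have "a * real (card I) / 4 = (\<Sum>i\<in>I. a / 2 ^ Suc i * (2 ^ i / 2))"
    by (simp add: field_simps)
  also have "\<dots> \<le> (\<Sum>i\<in>I. a / 2 ^ Suc i * real (card {s\<in>S. a / 2 ^ i \<le> q s}))"
    using assms by (intro sum_mono mult_left_mono) auto
  also have "\<dots> = (\<Sum>i\<in>I. \<Sum>s\<in>{s\<in>S. a / 2 ^ i \<le> q s}. a / 2 ^ Suc i)"
    by (simp add: mult.commute)
  also have "\<dots> = (\<Sum>s\<in>S. \<Sum>i\<in>{i\<in>I. a / 2 ^ i \<le> q s}. a / 2 ^ Suc i)"
    using assms by (intro sum.swap_restrict) auto
  also have "\<dots> \<le> (\<Sum>s\<in>S. q s)"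
    using assms by (intro sum_mono sum_dyadic_le) auto
  finally show ?thesis .
qed

section \<open>Concentration of the number of avoided slots\<close>

text \<open>Replacing the factors one at a time costs at most \<open>z\<close> each, because the
  other factors are at most 1. This bounds how far avoiding two slots with \<open>t\<close> keys is
  from being independent.\<close>

lemma power_diff_le_mult_diff:
  fixes x y z :: real
  assumes "0 \<le> x" "x \<le> 1" "0 \<le> y" "y \<le> 1" "x \<le> y + z" "0 \<le> z"
  shows "x ^ t \<le> y ^ t + real t * z"
proof (induction t)
  case (Suc t)
  have "x ^ Suc t = x * x ^ t" by simp
  also have "\<dots> \<le> x * (y ^ t + real t * z)" using Suc assms by (intro mult_left_mono) auto
  also have "\<dots> = x * y ^ t + x * (real t * z)" by (simp add: algebra_simps)
  also have "\<dots> \<le> (y + z) * y ^ t + 1 * (real t * z)"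
    using assms by (intro add_mono mult_right_mono) auto
  also have "\<dots> = y ^ Suc t + z * y ^ t + real t * z" by (simp add: algebra_simps)
  also have "\<dots> \<le> y ^ Suc t + z * 1 + real t * z"
    using assms by (intro add_mono mult_left_mono power_le_one) auto
  finally show ?case by (simp add: algebra_simps)
qed simp

lemma (in prob_space) expectation_sum_indicator:
  assumes "\<And>s. s \<in> S \<Longrightarrow> E s \<in> events"
  shows "integrable M (\<lambda>x. \<Sum>s\<in>S. indicator (E s) x :: real)"
    and "expectation (\<lambda>x. \<Sum>s\<in>S. indicator (E s) x) = (\<Sum>s\<in>S. prob (E s))"
proof -
  have int: "integrable M (indicator (E s) :: 'a \<Rightarrow> real)" if "s \<in> S" for s
    using assms[OF that] by (intro integrable_real_indicator) (simp_all add: emeasure_finite less_top[symmetric])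
  show "integrable M (\<lambda>x. \<Sum>s\<in>S. indicator (E s) x :: real)"
    by (intro Bochner_Integration.integrable_sum int)
  have "expectation (\<lambda>x. \<Sum>s\<in>S. indicator (E s) x) = (\<Sum>s\<in>S. expectation (indicator (E s) :: 'a \<Rightarrow> real))"
    by (intro Bochner_Integration.integral_sum int)
  also have "\<dots> = (\<Sum>s\<in>S. prob (E s))"
    using assms by (intro sum.cong) auto
  finally show "expectation (\<lambda>x. \<Sum>s\<in>S. indicator (E s) x) = (\<Sum>s\<in>S. prob (E s))" .
qed

text \<open>Second-moment method for the number \<open>X\<close> of elements of \<open>f\<close>
  avoided by all keys in \<open>J\<close>. The covariance of two avoidance events is at most
  \<open>card J\<close> times the probability that a single key hits both elements. Summed over all
  pairs, these probabilities give the second moment of \<open>card (Q x \<inter> f)\<close>, at most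
  \<open>c\<close> squared, so the dependence within one key's set \<open>Q x\<close> may be
  arbitrary.\<close>

lemma prob_card_avoided_le:
  fixes D :: "'a measure" and Q :: "'a \<Rightarrow> 's set" and J :: "'k set" and b v :: real
  assumes "prob_space D" "finite J" "finite f"
    and meas: "\<And>s. s \<in> f \<Longrightarrow> {x\<in>space D. s \<in> Q x} \<in> sets D"
    and card: "\<And>x. x \<in> space D \<Longrightarrow> card (Q x \<inter> f) \<le> c"
    and light: "\<And>s. s \<in> f \<Longrightarrow> \<P>(x in D. s \<in> Q x) \<le> b"
    and b: "0 \<le> b" "b < 1"
    and v: "v \<le> card f * (1 - b) ^ card J / 2"
    and f: "f \<noteq> {}"
  shows "\<P>(g in Pi\<^sub>M J (\<lambda>_. D). real (card {s\<in>f. \<forall>k\<in>J. s \<notin> Q (g k)}) \<le> v)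
           \<le> 4 * card J * (real c)\<^sup>2 / (card f * (1 - b) ^ card J)\<^sup>2"
    and "{g\<in>space (Pi\<^sub>M J (\<lambda>_. D)). real (card {s\<in>f. \<forall>k\<in>J. s \<notin> Q (g k)}) \<le> v} \<in> sets (Pi\<^sub>M J (\<lambda>_. D))"
proof -
  interpret D: prob_space D by fact
  interpret P: finite_product_prob_space "\<lambda>_::'k. D" J
    by (intro finite_product_prob_space.intro finite_product_sigma_finite.intro product_prob_space.intro
        finite_product_sigma_finite_axioms.intro product_sigma_finite.intro product_prob_space_axioms.intro) 
       (use assms in \<open>auto intro: D.sigma_finite_measure_axioms\<close>)
  let ?P = "Pi\<^sub>M J (\<lambda>_. D)"
  define U where "U s = {g\<in>space ?P. \<forall>k\<in>J. s \<notin> Q (g k)}" for s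
  define X where "X g = (\<Sum>s\<in>f. indicator (U s) g :: real)" for g
  define q where "q s = D.prob {x\<in>space D. s \<in> Q x}" for s
  define q2 where "q2 s s' = D.prob {x\<in>space D. s \<in> Q x \<and> s' \<in> Q x}" for s s'
  define t where "t = card J"
  define \<mu> where "\<mu> = (\<Sum>s\<in>f. (1 - q s) ^ t)"
  have meas2: "{x\<in>space D. s \<in> Q x \<and> s' \<in> Q x} \<in> sets D" if "s \<in> f" "s' \<in> f" for s s'
    by (intro sets.sets_Collect_conj meas that)
  have N: "{x\<in>space D. s \<notin> Q x} \<in> sets D" if "s \<in> f" for s
    using meas[OF that] by (rule sets.sets_Collect_neg)
  have N2: "{x\<in>space D. s \<notin> Q x \<and> s' \<notin> Q x} \<in> sets D" if "s \<in> f" "s' \<in> f" for s s'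
    by (intro sets.sets_Collect_conj N that)
  \<comment> \<open>Avoidance events and their pairwise intersections are boxes, so their
    probabilities are \<open>t\<close>-th powers of one-key probabilities.\<close>
  have UPi: "U s = (\<Pi>\<^sub>E k\<in>J. {x\<in>space D. s \<notin> Q x})" for s
    unfolding U_def by (auto simp: space_PiM PiE_iff extensional_def)
  have UUPi: "U s \<inter> U s' = (\<Pi>\<^sub>E k\<in>J. {x\<in>space D. s \<notin> Q x \<and> s' \<notin> Q x})" for s s'
    unfolding U_def by (auto simp: space_PiM PiE_iff extensional_def)
  have U[measurable]: "U s \<in> sets ?P" if "s \<in> f" for s
    unfolding UPi using assms N[OF that] by (intro sets_PiM_I_finite) auto
  have q1: "D.prob {x\<in>space D. s \<notin> Q x} = 1 - q s" if "s \<in> f" for s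
    unfolding q_def using D.prob_neg[OF meas[OF that]] by simp
  have PU: "P.prob (U s) = (1 - q s) ^ t" if "s \<in> f" for s
    unfolding UPi by (subst P.prob_times) (use N[OF that] q1[OF that] in \<open>auto simp: t_def\<close>)
  have PUU: "P.prob (U s \<inter> U s') = D.prob {x\<in>space D. s \<notin> Q x \<and> s' \<notin> Q x} ^ t"
    if "s \<in> f" "s' \<in> f" for s s'
    unfolding UUPi by (subst P.prob_times) (use N2[OF that] in \<open>auto simp: t_def\<close>)
  have q_bounds: "0 \<le> q s" "q s \<le> 1" for s unfolding q_def by auto
  have PUU_le: "P.prob (U s \<inter> U s') \<le> (1 - q s) ^ t * (1 - q s') ^ t + real t * q2 s s'"
    if "s \<in> f" "s' \<in> f" for s s'
  proof -
    let ?A = "{x\<in>space D. s \<in> Q x}" and ?B = "{x\<in>space D. s' \<in> Q x}"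
    have "D.prob (?A \<union> ?B) = q s + q s' - D.prob (?A \<inter> ?B)"
      unfolding q_def using meas that by (intro measure_Un3) (auto simp: D.fmeasurable_eq_sets)
    moreover have "?A \<inter> ?B = {x\<in>space D. s \<in> Q x \<and> s' \<in> Q x}" by auto
    moreover have "{x\<in>space D. s \<notin> Q x \<and> s' \<notin> Q x} = space D - (?A \<union> ?B)" by auto
    moreover have "D.prob (space D - (?A \<union> ?B)) = 1 - D.prob (?A \<union> ?B)"
      using meas that by (intro D.prob_compl) auto
    ultimately have "D.prob {x\<in>space D. s \<notin> Q x \<and> s' \<notin> Q x} = 1 - q s - q s' + q2 s s'"
      unfolding q2_def by simp
    \<comment> \<open>Adding the nonnegative term \<open>q s * q s'\<close> completes the product;
      \<open>q2 s s'\<close> becomes the error \<open>z\<close> of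
      \<open>power_diff_le_mult_diff\<close>.\<close>
    also have "\<dots> \<le> (1 - q s) * (1 - q s') + q2 s s'"
      using q_bounds by (simp add: algebra_simps)
    finally show ?thesis
      unfolding PUU[OF that] power_mult_distrib[symmetric]
      by (intro power_diff_le_mult_diff) (use q_bounds in \<open>auto simp: q2_def intro!: mult_le_one\<close>)
  qed
  have X_eq: "X g = real (card {s\<in>f. \<forall>k\<in>J. s \<notin> Q (g k)})" if "g \<in> space ?P" for g
  proof -
    have "X g = (\<Sum>s\<in>f. if (\<forall>k\<in>J. s \<notin> Q (g k)) then 1 else 0)"
      unfolding X_def U_def using that by (intro sum.cong) (auto simp: indicator_def)
    then show ?thesis using \<open>finite f\<close> by (simp add: sum.If_cases Int_def)
  qed
  have X_meas[measurable]: "X \<in> borel_measurable ?P"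
    unfolding X_def by (intro borel_measurable_sum borel_measurable_indicator U)
  have EX: "P.expectation X = \<mu>"
    unfolding X_def \<mu>_def by (simp add: P.expectation_sum_indicator(2) U PU)
  have X2: "(X g)\<^sup>2 = (\<Sum>p\<in>f \<times> f. indicator (U (fst p) \<inter> U (snd p)) g)" for g
    unfolding X_def power2_eq_square sum_product
    by (simp add: sum.cartesian_product indicator_inter_arith case_prod_unfold)
  have X2_int: "integrable ?P (\<lambda>g. (X g)\<^sup>2)"
    unfolding X2 by (intro P.expectation_sum_indicator(1)) (auto intro: U)
  have X_int: "integrable ?P X"
    unfolding X_def by (intro P.expectation_sum_indicator(1) U)
  have q2_sum: "(\<Sum>p\<in>f \<times> f. q2 (fst p) (snd p)) \<le> (real c)\<^sup>2"
  proof -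
    let ?E = "\<lambda>p. {x\<in>space D. fst p \<in> Q x \<and> snd p \<in> Q x}"
    have E: "?E p \<in> sets D" if "p \<in> f \<times> f" for p using that by (intro meas2) auto
    have "(\<Sum>p\<in>f \<times> f. q2 (fst p) (snd p)) = D.expectation (\<lambda>x. \<Sum>p\<in>f \<times> f. indicator (?E p) x)"
      unfolding q2_def using E by (rule D.expectation_sum_indicator(2)[symmetric])
    also have "\<dots> \<le> D.expectation (\<lambda>x. (real c)\<^sup>2)"
    proof (rule integral_mono)
      show "integrable D (\<lambda>x. \<Sum>p\<in>f \<times> f. indicator (?E p) x :: real)"
        using E by (rule D.expectation_sum_indicator(1))
      fix x assume x: "x \<in> space D"
      have "(\<Sum>p\<in>f \<times> f. indicator (?E p) x :: real)
          = (\<Sum>p\<in>f \<times> f. indicator (Q x) (fst p) * indicator (Q x) (snd p))"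
        using x by (intro sum.cong) (auto simp: indicator_def)
      also have "\<dots> = (\<Sum>s\<in>f. indicator (Q x) s) * (\<Sum>s\<in>f. indicator (Q x) s)"
        unfolding sum_product by (simp add: sum.cartesian_product case_prod_unfold)
      also have "(\<Sum>s\<in>f. indicator (Q x) s :: real) = real (card (Q x \<inter> f))"
        using \<open>finite f\<close> by (simp add: indicator_def sum_of_bool_eq Int_def conj_commute)
      also have "real (card (Q x \<inter> f)) * real (card (Q x \<inter> f)) \<le> real c * real c"
        using card[OF x] by (intro mult_mono) auto
      finally show "(\<Sum>p\<in>f \<times> f. indicator (?E p) x) \<le> (real c)\<^sup>2"
        by (simp add: power2_eq_square)
    qed auto
    finally show ?thesis by (simp add: D.prob_space)
  qed
  have "P.expectation (\<lambda>g. (X g)\<^sup>2) = (\<Sum>p\<in>f \<times> f. P.prob (U (fst p) \<inter> U (snd p)))"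
    unfolding X2 by (intro P.expectation_sum_indicator(2)) (auto intro: U)
  also have "\<dots> \<le> (\<Sum>p\<in>f \<times> f. (1 - q (fst p)) ^ t * (1 - q (snd p)) ^ t + real t * q2 (fst p) (snd p))"
    by (intro sum_mono PUU_le) auto
  also have "\<dots> = \<mu>\<^sup>2 + real t * (\<Sum>p\<in>f \<times> f. q2 (fst p) (snd p))"
    unfolding \<mu>_def power2_eq_square sum_product
    by (simp add: sum.distrib sum_distrib_left sum.cartesian_product case_prod_unfold)
  also have "\<dots> \<le> \<mu>\<^sup>2 + real t * (real c)\<^sup>2"
    using q2_sum by (intro add_left_mono mult_left_mono) auto
  finally have var: "P.variance X \<le> real t * (real c)\<^sup>2"
    by (subst P.variance_eq[OF X_int X2_int]) (simp add: EX)
  \<comment> \<open>\<open>\<mu>0\<close> is the lower bound for the mean that lightness provides;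
    \<open>v\<close> is at most half of it, so \<open>X g \<le> v\<close> forces a deviation of at
    least \<open>\<mu>0 / 2\<close> from the true mean.\<close>
  define \<mu>0 where "\<mu>0 = card f * (1 - b) ^ t"
  have "\<mu>0 = (\<Sum>s\<in>f. (1 - b) ^ t)" unfolding \<mu>0_def by simp
  also have "\<dots> \<le> \<mu>" unfolding \<mu>_def
    using light b by (intro sum_mono power_mono) (auto simp: q_def)
  finally have \<mu>_ge: "\<mu>0 \<le> \<mu>" .
  have \<mu>0_pos: "0 < \<mu>0" unfolding \<mu>0_def using f b \<open>finite f\<close> by (simp add: card_gt_0_iff)
  have eq: "{g\<in>space ?P. real (card {s\<in>f. \<forall>k\<in>J. s \<notin> Q (g k)}) \<le> v} = {g\<in>space ?P. X g \<le> v}"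
    using X_eq by auto
  then show "{g\<in>space ?P. real (card {s\<in>f. \<forall>k\<in>J. s \<notin> Q (g k)}) \<le> v} \<in> sets ?P"
    by simp
  have "\<mu>0 / 2 \<le> \<bar>X g - P.expectation X\<bar>" if "X g \<le> v" for g
    using \<mu>_ge v that \<mu>0_pos unfolding EX \<mu>0_def t_def by linarith
  then have "P.prob {g\<in>space ?P. X g \<le> v} \<le> P.prob {g\<in>space ?P. \<mu>0 / 2 \<le> \<bar>X g - P.expectation X\<bar>}"
    by (intro P.finite_measure_mono) auto
  also have "\<dots> \<le> P.variance X / (\<mu>0 / 2)\<^sup>2"
    using \<mu>0_pos by (intro P.Chebyshev_inequality X2_int) auto
  also have "\<dots> \<le> real t * (real c)\<^sup>2 / (\<mu>0 / 2)\<^sup>2"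
    using var by (intro divide_right_mono) auto
  also have "\<dots> = 4 * real t * (real c)\<^sup>2 / \<mu>0\<^sup>2" by (simp add: field_simps power2_eq_square)
  finally show "P.prob {g\<in>space ?P. real (card {s\<in>f. \<forall>k\<in>J. s \<notin> Q (g k)}) \<le> v}
      \<le> 4 * card J * (real c)\<^sup>2 / (card f * (1 - b) ^ card J)\<^sup>2"
    unfolding eq \<mu>0_def t_def by simp
qed


section \<open>Independence of early and late keys\<close>

text \<open>For a fixed seed, \<open>merge\<close> turns the event into a rectangle over the two
  blocks of keys. The factor for \<open>J\<close> does not depend on the seed and leaves the
  integral over \<open>R\<close>.\<close>

lemma emeasure_pair_PiM_Un_indep:
  fixes R :: "'r measure" and D :: "'a measure" and I J :: "'k set"
  assumes "prob_space D" "finite I" "finite J" and IJ: "I \<inter> J = {}"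
    and E1: "E1 \<in> sets (R \<Otimes>\<^sub>M Pi\<^sub>M I (\<lambda>_. D))" and E2: "E2 \<in> sets (Pi\<^sub>M J (\<lambda>_. D))"
  shows "emeasure (R \<Otimes>\<^sub>M Pi\<^sub>M (I \<union> J) (\<lambda>_. D))
      {\<omega>\<in>space (R \<Otimes>\<^sub>M Pi\<^sub>M (I \<union> J) (\<lambda>_. D)). (fst \<omega>, restrict (snd \<omega>) I) \<in> E1 \<and> restrict (snd \<omega>) J \<in> E2}
    = emeasure (R \<Otimes>\<^sub>M Pi\<^sub>M I (\<lambda>_. D)) E1 * emeasure (Pi\<^sub>M J (\<lambda>_. D)) E2"
    and "{\<omega>\<in>space (R \<Otimes>\<^sub>M Pi\<^sub>M (I \<union> J) (\<lambda>_. D)). (fst \<omega>, restrict (snd \<omega>) I) \<in> E1 \<and> restrict (snd \<omega>) J \<in> E2}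
      \<in> sets (R \<Otimes>\<^sub>M Pi\<^sub>M (I \<union> J) (\<lambda>_. D))"
proof -
  interpret D: prob_space D by fact
  interpret product_sigma_finite "\<lambda>_::'k. D" by standard
  interpret I: finite_product_sigma_finite "\<lambda>_::'k. D" I by standard fact
  interpret J: finite_product_sigma_finite "\<lambda>_::'k. D" J by standard fact
  interpret IJ: finite_product_sigma_finite "\<lambda>_::'k. D" "I \<union> J" by standard (use assms in auto)
  let ?PI = "Pi\<^sub>M I (\<lambda>_. D)" and ?PJ = "Pi\<^sub>M J (\<lambda>_. D)" and ?P = "Pi\<^sub>M (I \<union> J) (\<lambda>_. D)"
  let ?X = "{\<omega>\<in>space (R \<Otimes>\<^sub>M ?P). (fst \<omega>, restrict (snd \<omega>) I) \<in> E1 \<and> restrict (snd \<omega>) J \<in> E2}"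
  have rI: "(\<lambda>\<omega>. (fst \<omega>, restrict (snd \<omega>) I)) \<in> R \<Otimes>\<^sub>M ?P \<rightarrow>\<^sub>M R \<Otimes>\<^sub>M ?PI"
    by (intro measurable_Pair measurable_fst measurable_compose[OF measurable_snd measurable_restrict_subset]) auto
  have rJ: "(\<lambda>\<omega>. restrict (snd \<omega>) J) \<in> R \<Otimes>\<^sub>M ?P \<rightarrow>\<^sub>M ?PJ"
    by (rule measurable_compose[OF measurable_snd measurable_restrict_subset]) auto
  have "?X = ((\<lambda>\<omega>. (fst \<omega>, restrict (snd \<omega>) I)) -` E1 \<inter> space (R \<Otimes>\<^sub>M ?P))
      \<inter> ((\<lambda>\<omega>. restrict (snd \<omega>) J) -` E2 \<inter> space (R \<Otimes>\<^sub>M ?P))" by auto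
  also have "\<dots> \<in> sets (R \<Otimes>\<^sub>M ?P)"
    by (intro sets.Int measurable_sets[OF rI E1] measurable_sets[OF rJ E2])
  finally show X: "?X \<in> sets (R \<Otimes>\<^sub>M ?P)" .
  have sec: "emeasure ?P (Pair r -` ?X) = emeasure ?PI (Pair r -` E1) * emeasure ?PJ E2"
    if r: "r \<in> space R" for r
  proof -
    have Xr: "Pair r -` ?X \<in> sets ?P" using X by (rule sets_Pair1)
    have E1r: "Pair r -` E1 \<in> sets ?PI" using E1 by (rule sets_Pair1)
    have "emeasure ?P (Pair r -` ?X)
        = emeasure (distr (?PI \<Otimes>\<^sub>M ?PJ) ?P (merge I J)) (Pair r -` ?X)"
      using assms by (subst distr_merge) auto
    also have "\<dots> = emeasure (?PI \<Otimes>\<^sub>M ?PJ) (merge I J -` (Pair r -` ?X) \<inter> space (?PI \<Otimes>\<^sub>M ?PJ))"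
      by (intro emeasure_distr measurable_merge Xr)
    also have "merge I J -` (Pair r -` ?X) \<inter> space (?PI \<Otimes>\<^sub>M ?PJ) = (Pair r -` E1) \<times> E2"
    proof -
      have "merge I J (x, y) \<in> space ?P" if "x \<in> space ?PI" "y \<in> space ?PJ" for x y
        using measurable_space[OF measurable_merge, of "(x, y)" I "\<lambda>_. D" J] that
        by (simp add: space_pair_measure)
      moreover have "restrict (merge I J (x, y)) I = x" "restrict (merge I J (x, y)) J = y"
        if "x \<in> space ?PI" "y \<in> space ?PJ" for x y
        using that IJ by (auto simp: space_PiM PiE_def extensional_restrict)
      ultimately show ?thesis
        using r sets.sets_into_space[OF E1r] sets.sets_into_space[OF E2]
        by (fastforce simp: space_pair_measure)
    qed
    also have "emeasure (?PI \<Otimes>\<^sub>M ?PJ) \<dots> = emeasure ?PI (Pair r -` E1) * emeasure ?PJ E2"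
      using E1r E2 by (rule J.emeasure_pair_measure_Times)
    finally show ?thesis .
  qed
  have "emeasure (R \<Otimes>\<^sub>M ?P) ?X = (\<integral>\<^sup>+r. emeasure ?P (Pair r -` ?X) \<partial>R)"
    using X by (rule IJ.emeasure_pair_measure_alt)
  also have "\<dots> = (\<integral>\<^sup>+r. emeasure ?PI (Pair r -` E1) * emeasure ?PJ E2 \<partial>R)"
    by (intro nn_integral_cong sec)
  also have "\<dots> = emeasure (R \<Otimes>\<^sub>M ?PI) E1 * emeasure ?PJ E2"
    by (subst nn_integral_multc) (auto intro: I.measurable_emeasure_Pair E1 simp: I.emeasure_pair_measure_alt[OF E1])
  finally show "emeasure (R \<Otimes>\<^sub>M ?P) ?X = emeasure (R \<Otimes>\<^sub>M ?PI) E1 * emeasure ?PJ E2" .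
qed

section \<open>Powers of 2 in an interval\<close>

lemma finite_dyadic: "finite {i. x \<le> 2 ^ i \<and> 2 ^ i \<le> (y::real)}"
proof -
  obtain N where N: "y < 2 ^ N" using real_arch_pow[of 2 y] by auto
  have "{i. x \<le> 2 ^ i \<and> 2 ^ i \<le> y} \<subseteq> {..N}"
  proof
    fix i assume "i \<in> {i. x \<le> 2 ^ i \<and> 2 ^ i \<le> y}"
    then have "2 ^ i \<le> y" by simp
    then have "(2::real) ^ i < 2 ^ N" using N by (rule order.strict_trans1)
    then show "i \<in> {..N}" by simp
  qed
  then show ?thesis by (rule finite_subset) simp
qed

text \<open>The exponents from the ceiling of \<open>log 2 x\<close> to the floor of
  \<open>log 2 y\<close> all qualify. Since \<open>1 \<le> x\<close>, both logarithms are
  nonnegative and \<open>nat\<close> truncates nothing.\<close>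

lemma card_dyadic_ge:
  fixes x y :: real
  assumes "1 \<le> x" "x \<le> y"
  shows "log 2 (y / x) - 1 \<le> real (card {i. x \<le> 2 ^ i \<and> 2 ^ i \<le> y})"
proof -
  define u where "u = nat \<lceil>log 2 x\<rceil>"
  define w where "w = nat \<lfloor>log 2 y\<rfloor>"
  have nonneg: "0 \<le> log 2 x" "0 \<le> log 2 y" using assms by auto
  have "{u..w} \<subseteq> {i. x \<le> 2 ^ i \<and> 2 ^ i \<le> y}"
  proof safe
    fix i assume i: "i \<in> {u..w}"
    have "log 2 x \<le> real i" "real i \<le> log 2 y"
      using i nonneg unfolding u_def w_def by (auto simp: le_nat_iff nat_le_iff ceiling_le_iff le_floor_iff)
    then have "x \<le> 2 powr real i" "2 powr real i \<le> y"
      using assms by (simp_all add: log_le_iff le_log_iff)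
    then show "x \<le> 2 ^ i" "2 ^ i \<le> y" by (simp_all add: powr_realpow)
  qed
  then have "card {u..w} \<le> card {i. x \<le> 2 ^ i \<and> 2 ^ i \<le> y}"
    by (intro card_mono finite_dyadic)
  moreover have "log 2 y - log 2 x - 1 \<le> real (card {u..w})"
  proof -
    have "real u < log 2 x + 1" "log 2 y < real w + 1"
      using nonneg unfolding u_def w_def by linarith+
    \<comment> \<open>The cardinality is \<open>Suc w - u\<close> with truncated subtraction; where
      truncation occurs, the left-hand side is negative.\<close>
    then show ?thesis by (cases "u \<le> Suc w") (auto simp: of_nat_diff)
  qed
  ultimately show ?thesis using assms by (simp add: log_divide)
qed

section \<open>Measurability and probe statistics of a scheme\<close>

context open_addressing
begin

lemma space_D: "space D = (\<Pi>\<^sub>E j\<in>{1..}. {1..n})"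
  using sets_eq_imp_space_eq[OF sets_D] by (simp add: probe_seqs_def space_PiM)

text \<open>Index 0 lies outside the index set of the product, where extensionality makes the
  coordinate constant. It is covered because \<open>measurable_slot\<close> composes with every
  possible value of the chosen probe index.\<close>

lemma measurable_probe: "(\<lambda>h. h j) \<in> D \<rightarrow>\<^sub>M count_space UNIV"
proof (cases "j \<ge> 1")
  case True
  then have probe: "(\<lambda>h. h j) \<in> probe_seqs n \<rightarrow>\<^sub>M count_space {1..n}"
    unfolding probe_seqs_def by (intro measurable_component_singleton) auto
  have "(\<lambda>s. s) \<in> count_space {1..n} \<rightarrow>\<^sub>M count_space (UNIV :: nat set)" by simp
  from measurable_compose[OF probe this] show ?thesis
    unfolding measurable_cong_sets[OF sets_D refl] .
next
  case False
  then have "h j = undefined" if "h \<in> space D" for h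
    using that unfolding space_D by (auto simp: PiE_def extensional_def)
  then show ?thesis by (subst measurable_cong[where g = "\<lambda>_. undefined"]) auto
qed

lemma sets_probed: "{h\<in>space D. s \<in> h ` {1..c}} \<in> sets D"
proof -
  have "{h\<in>space D. s \<in> h ` {1..c}} = (\<Union>j\<in>{1..c}. ((\<lambda>h. h j) -` {s} \<inter> space D))" by auto
  also have "\<dots> \<in> sets D" by (intro sets.finite_UN measurable_sets[OF measurable_probe]) auto
  finally show ?thesis .
qed

text \<open>The left-hand side is the expected number of distinct slots among the first
  \<open>c\<close> probes.\<close>

lemma sum_prob_probed_le: "(\<Sum>s\<in>{1..n}. \<P>(h in D. s \<in> h ` {1..c})) \<le> c"
proof -
  interpret D: prob_space D by (rule prob_space_D)
  have "(\<Sum>s\<in>{1..n}. \<P>(h in D. s \<in> h ` {1..c}))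
      = D.expectation (\<lambda>h. \<Sum>s\<in>{1..n}. indicator {h\<in>space D. s \<in> h ` {1..c}} h)"
    by (intro D.expectation_sum_indicator(2)[symmetric] sets_probed)
  also have "\<dots> \<le> D.expectation (\<lambda>_. real c)"
  proof (rule integral_mono)
    show "integrable D (\<lambda>h. \<Sum>s\<in>{1..n}. indicator {h\<in>space D. s \<in> h ` {1..c}} h :: real)"
      by (intro D.expectation_sum_indicator(1) sets_probed)
    fix h assume "h \<in> space D"
    then have "(\<Sum>s\<in>{1..n}. indicator {h\<in>space D. s \<in> h ` {1..c}} h :: real)
        = (\<Sum>s\<in>{1..n}. indicator (h ` {1..c}) s)"
      by (intro sum.cong) (auto simp: indicator_def)
    also have "\<dots> = real (card ({1..n} \<inter> h ` {1..c}))" by (simp add: indicator_def sum_of_bool_eq Int_def)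
    also have "\<dots> \<le> real (card {1..c})"
      by (intro of_nat_mono order.trans[OF card_mono card_image_le]) auto
    finally show "(\<Sum>s\<in>{1..n}. indicator {h\<in>space D. s \<in> h ` {1..c}} h) \<le> real c" by simp
  qed auto
  finally show ?thesis by (simp add: D.prob_space)
qed

lemma measurable_probe_complexity:
  assumes "1 \<le> i" "i \<le> k" "k \<le> m"
  shows "probe_complexity A i \<in> R \<Otimes>\<^sub>M (\<Pi>\<^sub>M i\<in>{1..k}. D) \<rightarrow>\<^sub>M count_space UNIV"
proof -
  have "(\<lambda>\<omega>. (fst \<omega>, restrict (snd \<omega>) {1..i})) \<in> R \<Otimes>\<^sub>M (\<Pi>\<^sub>M i\<in>{1..k}. D) \<rightarrow>\<^sub>M R \<Otimes>\<^sub>M (\<Pi>\<^sub>M k\<in>{1..i}. D)"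
    using assms
    by (intro measurable_Pair measurable_fst measurable_compose[OF measurable_snd measurable_restrict_subset]) auto
  then show ?thesis
    unfolding probe_complexity_def[abs_def] by (rule measurable_compose) (use assms measurable_A[of i] in simp)
qed

lemma measurable_slot:
  assumes "1 \<le> i" "i \<le> k" "k \<le> m"
  shows "slot A i \<in> R \<Otimes>\<^sub>M (\<Pi>\<^sub>M i\<in>{1..k}. D) \<rightarrow>\<^sub>M count_space UNIV"
proof -
  have "(\<lambda>\<omega>. snd \<omega> i j) \<in> R \<Otimes>\<^sub>M (\<Pi>\<^sub>M i\<in>{1..k}. D) \<rightarrow>\<^sub>M count_space UNIV" for j
    using assms
    by (intro measurable_compose[OF _ measurable_probe]
        measurable_compose[OF measurable_snd measurable_component_singleton]) auto
  then show ?thesis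
    unfolding slot_def[abs_def]
    by (rule measurable_compose_countable[OF _ measurable_probe_complexity[OF assms]])
qed

text \<open>This is where the online property enters: the slots taken by the first \<open>k\<close>
  keys can be read off the seed and these keys alone.\<close>

lemma slot_restrict:
  assumes "1 \<le> i" "i \<le> k"
  shows "slot A i (r, restrict h {1..k}) = slot A i (r, h)"
proof -
  have "{1..k} \<inter> {1..i} = {1..i}" using assms by auto
  then show ?thesis using assms by (simp add: slot_def probe_complexity_def restrict_restrict)
qed

lemma prob_space_seed_keys: "prob_space (R \<Otimes>\<^sub>M (\<Pi>\<^sub>M i\<in>{1..k::nat}. D))"
proof -
  interpret R: prob_space R by (rule prob_space_R)
  interpret P: prob_space "\<Pi>\<^sub>M i\<in>{1..k}. D" by (intro prob_space_PiM prob_space_D)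
  interpret RP: pair_prob_space R "\<Pi>\<^sub>M i\<in>{1..k}. D" ..
  show ?thesis by (rule RP.prob_space_axioms)
qed

section \<open>Success probability for a fixed number of late keys\<close>

text \<open>The argument conditions on the set \<open>f\<close> of light slots still free after the
  first \<open>m - t\<close> keys. If all complexities are at most \<open>c\<close>, a slot of
  \<open>f\<close> outside the first \<open>c\<close> probes of every late key stays empty, so at
  most \<open>n - m\<close> slots are of this kind. That count involves only \<open>f\<close> and
  the late probe sequences, whatever the algorithm does with them, so
  \<open>prob_card_avoided_le\<close> applies for each \<open>f\<close>.\<close>

lemma prob_all_probe_complexity_le:
  fixes b :: real
  assumes t: "1 \<le> t" "t \<le> m" and mn: "m \<le> n" and b: "0 \<le> b" "b < 1"
    and few: "card {s\<in>{1..n}. b \<le> \<P>(h in D. s \<in> h ` {1..c})} \<le> t / 2"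
    and gap: "real n - real m \<le> t * (1 - b) ^ t / 4"
  shows "\<P>(\<omega> in runs m D R. \<forall>i\<in>{1..m}. probe_complexity A i \<omega> \<le> c)
     \<le> 16 * (real c)\<^sup>2 / (t * (1 - b) ^ (2 * t))"
proof -
  define k where "k = m - t"
  define I where "I = {1..k}"
  define J where "J = {k+1..m}"
  have IJ: "{1..m} = I \<union> J" "I \<inter> J = {}" "finite I" "finite J" "card J = t" "card I = k"
    using t unfolding I_def J_def k_def by auto
  let ?q = "\<lambda>s. \<P>(h in D. s \<in> h ` {1..c})"
  let ?P1 = "R \<Otimes>\<^sub>M Pi\<^sub>M I (\<lambda>_. D)" and ?PJ = "Pi\<^sub>M J (\<lambda>_. D)"
  interpret P: prob_space "runs m D R" unfolding runs_def by (rule prob_space_seed_keys)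
  interpret P1: prob_space ?P1 unfolding I_def by (rule prob_space_seed_keys)
  interpret PJ: prob_space ?PJ by (intro prob_space_PiM prob_space_D)
  have runs: "runs m D R = R \<Otimes>\<^sub>M Pi\<^sub>M (I \<union> J) (\<lambda>_. D)" unfolding runs_def IJ(1) ..
  define B where "B = {s\<in>{1..n}. ?q s < b}"
  have "card {1..n} = card (B \<union> {s\<in>{1..n}. b \<le> ?q s})"
    unfolding B_def by (intro arg_cong[where f=card]) auto
  also have "\<dots> \<le> card B + card {s\<in>{1..n}. b \<le> ?q s}" by (rule card_Un_le)
  finally have card_B: "real n \<le> card B + t / 2" using few by simp
  \<comment> \<open>\<open>E1 f\<close> fixes the free light slots before the late keys,
    \<open>E2 f\<close> says that the late keys avoid few of them, and \<open>FF\<close> collects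
    the values of \<open>f\<close> that are large enough to occur under success.\<close>
  define E1 where "E1 f = {x\<in>space ?P1. B - (\<lambda>i. slot A i x) ` I = f}" for f
  define E2 where "E2 f = {g\<in>space ?PJ. real (card {s\<in>f. \<forall>i\<in>J. s \<notin> g i ` {1..c}}) \<le> real n - real m}" for f
  define FF where "FF = {f\<in>Pow B. t / 2 \<le> real (card f)}"
  have finB: "finite B" unfolding B_def by simp
  have finFF: "finite FF" unfolding FF_def using finB by simp
  define G where "G f = {\<omega>\<in>space (R \<Otimes>\<^sub>M Pi\<^sub>M (I \<union> J) (\<lambda>_. D)).
    (fst \<omega>, restrict (snd \<omega>) I) \<in> E1 f \<and> restrict (snd \<omega>) J \<in> E2 f}" for f
  let ?\<epsilon> = "16 * (real c)\<^sup>2 / (t * (1 - b) ^ (2 * t))"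
  have E1: "E1 f \<in> sets ?P1" if "f \<in> FF" for f
  proof -
    \<comment> \<open>Membership is spelled out slot by slot so that \<open>E1 f\<close> becomes a
      finite Boolean combination of events \<open>slot A i x = s\<close>.\<close>
    have eq: "B - S = f \<longleftrightarrow> (\<forall>s\<in>B. (s \<in> f \<longrightarrow> s \<notin> S) \<and> (s \<notin> f \<longrightarrow> s \<in> S))" for S
      using that unfolding FF_def by blast
    have "E1 f = {x\<in>space ?P1. \<forall>s\<in>B. (s \<in> f \<longrightarrow> \<not> (\<exists>i\<in>I. slot A i x = s)) \<and> (s \<notin> f \<longrightarrow> (\<exists>i\<in>I. slot A i x = s))}"
      unfolding E1_def eq by (simp add: image_iff eq_commute)
    also have "\<dots> \<in> sets ?P1"
    proof -
      have "{x\<in>space ?P1. slot A i x = s} \<in> sets ?P1" if "i \<in> I" for i s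
      proof -
        have "slot A i \<in> ?P1 \<rightarrow>\<^sub>M count_space UNIV"
          using that unfolding I_def k_def by (intro measurable_slot) auto
        from measurable_sets[OF this, of "{s}"] show ?thesis
          by (simp add: vimage_def Int_def conj_commute)
      qed
      then show ?thesis
        using finB IJ(3) by (intro sets.sets_Collect_finite_All sets.sets_Collect_finite_Ex
            sets.sets_Collect_neg sets.sets_Collect_const sets.sets_Collect_conj sets.sets_Collect_imp) auto
    qed
    finally show ?thesis .
  qed
  have E2: "E2 f \<in> sets ?PJ \<and> PJ.prob (E2 f) \<le> ?\<epsilon>" if f: "f \<in> FF" for f
  proof -
    have f': "f \<subseteq> B" "t / 2 \<le> real (card f)" using f unfolding FF_def by auto
    have fin: "finite f" using f' finB finite_subset by blast
    have ne: "f \<noteq> {}" using f' t by auto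
    have probes: "card (h ` {1..c} \<inter> f) \<le> c" for h :: "nat \<Rightarrow> nat"
    proof -
      have "card (h ` {1..c} \<inter> f) \<le> card (h ` {1..c})" by (intro card_mono) auto
      also have "\<dots> \<le> card {1..c}" by (rule card_image_le) simp
      finally show ?thesis by simp
    qed
    have light: "?q s \<le> b" if "s \<in> f" for s using that f' unfolding B_def by auto
    have gap': "real n - real m \<le> card f * (1 - b) ^ card J / 2"
    proof -
      have "t / 2 * (1 - b) ^ t \<le> card f * (1 - b) ^ t"
        using f' b by (intro mult_right_mono) auto
      then show ?thesis using gap IJ by simp
    qed
    note avoided = prob_card_avoided_le[where Q = "\<lambda>h. h ` {1..c}",
        OF prob_space_D IJ(4) fin sets_probed probes light b gap' ne]
    have *: "E2 f \<in> sets ?PJ" unfolding E2_def by (rule avoided(2))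
    have **: "PJ.prob (E2 f) \<le> 4 * t * (real c)\<^sup>2 / (card f * (1 - b) ^ t)\<^sup>2"
      using avoided(1) unfolding E2_def IJ(5) .
    \<comment> \<open>The size bound \<open>t / 2 \<le> card f\<close> makes the estimate uniform in
      \<open>f\<close>.\<close>
    have "4 * t * (real c)\<^sup>2 / (card f * (1 - b) ^ t)\<^sup>2 \<le> 4 * t * (real c)\<^sup>2 / (t / 2 * (1 - b) ^ t)\<^sup>2"
    proof (intro divide_left_mono power_mono mult_right_mono)
      show "0 < (card f * (1 - b) ^ t)\<^sup>2 * (t / 2 * (1 - b) ^ t)\<^sup>2"
        using fin ne b t by (simp add: card_gt_0_iff)
    qed (use f' b t in simp_all)
    also have "\<dots> = ?\<epsilon>"
    proof -
      define y where "y = (1 - b) ^ t"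
      have "0 < y" using b unfolding y_def by simp
      then show ?thesis
        using t unfolding power_even_eq y_def[symmetric] by (simp add: power2_eq_square field_simps)
    qed
    finally show ?thesis using * ** by linarith
  qed
  have G: "G f \<in> sets (runs m D R)" "P.prob (G f) = P1.prob (E1 f) * PJ.prob (E2 f)" if "f \<in> FF" for f
  proof -
    note indep = emeasure_pair_PiM_Un_indep[OF prob_space_D IJ(3,4,2) E1[OF that] conjunct1[OF E2[OF that]]]
    show "G f \<in> sets (runs m D R)" unfolding runs G_def by (rule indep(2))
    show "P.prob (G f) = P1.prob (E1 f) * PJ.prob (E2 f)"
      unfolding measure_def runs G_def indep(1) by (rule enn2real_mult)
  qed
  \<comment> \<open>The inclusion holds only almost everywhere, since \<open>placed\<close> excludes
    collisions and the probe index 0 only up to a null set.\<close>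
  have "AE \<omega> in runs m D R. (\<forall>i\<in>{1..m}. probe_complexity A i \<omega> \<le> c) \<longrightarrow> \<omega> \<in> (\<Union>f\<in>FF. G f)"
    using placed AE_space
  proof eventually_elim
    case (elim \<omega>)
    show ?case
    proof
      assume le: "\<forall>i\<in>{1..m}. probe_complexity A i \<omega> \<le> c"
      let ?f = "B - (\<lambda>i. slot A i \<omega>) ` I"
      have sp: "fst \<omega> \<in> space R" "snd \<omega> \<in> (\<Pi>\<^sub>E i\<in>I \<union> J. space D)"
        using elim(2) unfolding runs by (auto simp: space_pair_measure space_PiM)
      have pc: "probe_complexity A i \<omega> \<in> {1..c}" if "i \<in> {1..m}" for i
        using le elim(1) that by auto
      have inj: "inj_on (\<lambda>i. slot A i \<omega>) {1..m}"
      proof (rule linorder_inj_onI)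
        fix x y :: nat assume xy: "x < y" "x \<in> {1..m}" "y \<in> {1..m}"
        then have "x \<in> {1..<y}" by simp
        then have "slot A y \<omega> \<noteq> slot A x \<omega>" using elim(1) xy(3) by blast
        then show "slot A x \<omega> \<noteq> slot A y \<omega>" by (rule not_sym)
      qed auto
      have ran: "slot A i \<omega> \<in> {1..n}" if "i \<in> {1..m}" for i
      proof -
        have "snd \<omega> i \<in> space D" using sp that IJ(1) by (auto simp: PiE_iff)
        then show ?thesis using pc[OF that] unfolding space_D slot_def by (auto simp: PiE_iff)
      qed
      have "real (card B) \<le> real (card ?f) + real k"
      proof -
        have "card B - card ((\<lambda>i. slot A i \<omega>) ` I) \<le> card ?f"
          using IJ by (intro diff_card_le_card_Diff) auto
        moreover have "card ((\<lambda>i. slot A i \<omega>) ` I) \<le> k" using card_image_le[OF IJ(3)] IJ by metis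
        ultimately show ?thesis by linarith
      qed
      \<comment> \<open>At least \<open>n - t / 2\<close> slots are light, at most
        \<open>m - t\<close> are taken, and \<open>m \<le> n\<close>.\<close>
      then have "t / 2 \<le> real (card ?f)"
        using card_B t mn unfolding k_def by (simp add: of_nat_diff)
      then have f: "?f \<in> FF" unfolding FF_def by auto
      have e1: "(fst \<omega>, restrict (snd \<omega>) I) \<in> E1 ?f"
      proof -
        have "(\<lambda>i. slot A i (fst \<omega>, restrict (snd \<omega>) I)) ` I = (\<lambda>i. slot A i \<omega>) ` I"
          unfolding I_def
        proof (intro image_cong refl)
          fix i assume "i \<in> {1..k}"
          then show "slot A i (fst \<omega>, restrict (snd \<omega>) {1..k}) = slot A i \<omega>"
            using slot_restrict[of i k "fst \<omega>" "snd \<omega>"] by simp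
        qed
        then show ?thesis unfolding E1_def using sp
          by (auto simp: space_pair_measure space_PiM PiE_iff)
      qed
      have e2: "restrict (snd \<omega>) J \<in> E2 ?f"
      proof -
        have "{s\<in>?f. \<forall>i\<in>J. s \<notin> restrict (snd \<omega>) J i ` {1..c}} \<subseteq> {1..n} - (\<lambda>i. slot A i \<omega>) ` {1..m}"
        proof safe
          fix i assume s: "slot A i \<omega> \<in> B" "slot A i \<omega> \<notin> (\<lambda>i. slot A i \<omega>) ` I" "i \<in> {1..m}"
            "\<forall>j\<in>J. slot A i \<omega> \<notin> restrict (snd \<omega>) J j ` {1..c}"
          then have "i \<in> J" using IJ(1) by auto
          then have "slot A i \<omega> \<in> restrict (snd \<omega>) J i ` {1..c}"
            unfolding slot_def using pc[OF s(3)] by auto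
          then show False using s(4) \<open>i \<in> J\<close> by blast
        qed (auto simp: B_def)
        then have "card {s\<in>?f. \<forall>i\<in>J. s \<notin> restrict (snd \<omega>) J i ` {1..c}}
            \<le> card ({1..n} - (\<lambda>i. slot A i \<omega>) ` {1..m})"
          by (intro card_mono) auto
        also have "\<dots> = n - m"
        proof -
          have "card ((\<lambda>i. slot A i \<omega>) ` {1..m}) = m" using card_image[OF inj] by simp
          moreover have "(\<lambda>i. slot A i \<omega>) ` {1..m} \<subseteq> {1..n}" using ran by blast
          ultimately show ?thesis by (simp add: card_Diff_subset)
        qed
        finally show ?thesis unfolding E2_def using sp mn
          by (auto simp: space_PiM PiE_iff of_nat_diff)
      qed
      have "\<omega> \<in> G ?f" unfolding G_def using e1 e2 elim(2) runs by simp
      then show "\<omega> \<in> (\<Union>f\<in>FF. G f)" using f by blast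
    qed
  qed
  then have "P.prob {\<omega>\<in>space (runs m D R). \<forall>i\<in>{1..m}. probe_complexity A i \<omega> \<le> c} \<le> P.prob (\<Union>f\<in>FF. G f)"
    using G finFF by (intro P.finite_measure_mono_AE) auto
  also have "\<dots> \<le> (\<Sum>f\<in>FF. P.prob (G f))"
    using G finFF by (intro P.finite_measure_subadditive_finite) auto
  also have "\<dots> \<le> (\<Sum>f\<in>FF. P1.prob (E1 f) * ?\<epsilon>)"
  proof (rule sum_mono)
    fix f assume "f \<in> FF"
    then show "P.prob (G f) \<le> P1.prob (E1 f) * ?\<epsilon>"
      unfolding G(2)[OF \<open>f \<in> FF\<close>] using E2 by (intro mult_left_mono) auto
  qed
  also have "\<dots> = P1.prob (\<Union>f\<in>FF. E1 f) * ?\<epsilon>"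
  proof -
    \<comment> \<open>Disjointness of the \<open>E1 f\<close> means that summing over all
      \<open>f\<close> costs no factor for the number of possible free sets.\<close>
    have "disjoint_family_on E1 FF" unfolding disjoint_family_on_def E1_def by blast
    then have "P1.prob (\<Union>f\<in>FF. E1 f) = (\<Sum>f\<in>FF. P1.prob (E1 f))"
      using E1 finFF by (intro P1.finite_measure_finite_Union) auto
    then show ?thesis by (simp only: sum_distrib_right)
  qed
  also have "\<dots> \<le> 1 * ?\<epsilon>"
    using b by (intro mult_right_mono) auto
  finally show ?thesis by simp
qed

section \<open>Choice of parameters\<close>

text \<open>The dyadic charging yields a power of 2, \<open>t\<close>, with few slots above
  \<open>b = l / (16 * t)\<close>. Then \<open>(1 - b) ^ t\<close> is at least
  \<open>exp (- l / 8)\<close> while \<open>t\<close> is at least \<open>exp (3 * l / 4)\<close>, so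
  the Chebyshev bound is at most \<open>16 * c ^ 2 / exp (l / 2)\<close>.\<close>

lemma prob_all_probe_complexity_less_half:
  assumes \<delta>: "0 < \<delta>" "\<delta> < 1" and m: "real m = real n * (1 - \<delta>)" and n: "0 < n"
    and l: "l = ln (1 / \<delta>)" "16 \<le> l" and c: "real c \<le> l\<^sup>2 / 1024"
  shows "\<P>(\<omega> in runs m D R. \<forall>i\<in>{1..m}. probe_complexity A i \<omega> \<le> c) < 1 / 2"
proof -
  let ?q = "\<lambda>s. \<P>(h in D. s \<in> h ` {1..c})"
  have \<delta>_l: "\<delta> = exp (- l)" using \<delta> l by (simp add: ln_div exp_minus)
  have gap: "real n - real m = real n * exp (- l)" using m by (simp add: \<delta>_l algebra_simps)
  \<comment> \<open>The number \<open>n - m = n * exp (- l)\<close> is a positive integer, hence at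
    least 1.\<close>
  have n_ge: "exp l \<le> real n"
  proof -
    have "0 < real n - real m" using gap n by simp
    then have "m < n" by simp
    then have "1 \<le> real n - real m" by linarith
    then show ?thesis unfolding gap by (simp add: exp_minus field_simps)
  qed
  define x where "x = real n * exp (- l / 4)"
  have x_ge: "exp (3 * l / 4) \<le> x"
  proof -
    have "exp (3 * l / 4) = exp l * exp (- l / 4)" by (simp flip: exp_add)
    then show ?thesis unfolding x_def using n_ge by simp
  qed
  have exp4: "2 \<le> exp (l / 4)" using exp_ge_add_one_self[of "l / 4"] l by linarith
  define I where "I = {i. x \<le> 2 ^ i \<and> 2 ^ i \<le> real n / 2}"
  have finI: "finite I" unfolding I_def by (rule finite_dyadic)
  \<comment> \<open>The count is at least \<open>l / 4 - 2\<close>: one is lost to the upper end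
    \<open>n / 2\<close>, one to rounding. This is where \<open>16 \<le> l\<close> is sharp.\<close>
  have "l / 8 \<le> real (card I)"
  proof -
    have "1 \<le> x" using x_ge l by (meson one_le_exp_iff order.trans divide_nonneg_nonneg mult_nonneg_nonneg zero_le_numeral)
    moreover have "x \<le> real n / 2"
      unfolding x_def using exp4 n by (simp add: exp_minus field_simps)
    ultimately have "log 2 (real n / 2 / x) - 1 \<le> real (card I)"
      unfolding I_def by (rule card_dyadic_ge)
    moreover have "log 2 (real n / 2 / x) = log 2 (exp (l / 4)) - 1"
    proof -
      have eq: "real n / 2 / x = exp (l / 4) / 2"
        unfolding x_def using n by (simp add: exp_minus field_simps)
      show ?thesis unfolding eq by (subst log_divide) simp_all
    qed
    moreover have "l / 4 \<le> log 2 (exp (l / 4))"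
    proof -
      have "ln 2 \<le> (1::real)" using ln_le_minus_one[of 2] by simp
      then show ?thesis using l by (simp add: log_def field_simps)
    qed
    ultimately show ?thesis using l by linarith
  qed
  \<comment> \<open>If every level were well populated, the \<open>q s\<close> would sum to at least
    \<open>(l / 16) * (l / 8) / 4\<close>, which is \<open>l ^ 2 / 512\<close> and exceeds the bound
    on \<open>c\<close>.\<close>
  have "\<exists>i\<in>I. real (card {s\<in>{1..n}. l / 16 / 2 ^ i \<le> ?q s}) < 2 ^ i / 2"
  proof (rule ccontr)
    assume "\<not> ?thesis"
    then have "l / 16 * real (card I) / 4 \<le> (\<Sum>s\<in>{1..n}. ?q s)"
      using l finI by (intro dyadic_levels_sum_ge) (auto simp: not_less)
    also have "\<dots> \<le> l\<^sup>2 / 1024" using sum_prob_probed_le c by (rule order.trans)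
    finally have "l / 16 * real (card I) / 4 \<le> l\<^sup>2 / 1024" .
    moreover have "l / 16 * (l / 8) / 4 \<le> l / 16 * real (card I) / 4"
      using \<open>l / 8 \<le> real (card I)\<close> l by (intro divide_right_mono mult_left_mono) auto
    moreover have "0 < l * l" using l by simp
    ultimately show False unfolding power2_eq_square by simp
  qed
  then obtain i where i: "i \<in> I" "real (card {s\<in>{1..n}. l / 16 / 2 ^ i \<le> ?q s}) < 2 ^ i / 2" by blast
  define t :: nat where "t = 2 ^ i"
  define b where "b = l / 16 / t"
  have t: "1 \<le> t" "x \<le> real t" "real t \<le> real n / 2"
    using i(1) unfolding t_def I_def by auto
  have t_ge: "exp (3 * l / 4) \<le> real t" using x_ge t by linarith
  have b: "0 \<le> b" "b \<le> 1 / 2"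
  proof -
    have "l / 16 \<le> real t / 2" using t_ge exp_ge_add_one_self[of "3 * l / 4"] l by linarith
    then show "b \<le> 1 / 2" unfolding b_def using t by (simp add: field_simps)
  qed (use l in \<open>simp add: b_def\<close>)
  have pow_ge: "exp (- l / 8) \<le> (1 - b) ^ t"
  proof -
    have "- b - 2 * b\<^sup>2 \<le> ln (1 - b)" using b by (intro ln_one_minus_pos_lower_bound)
    moreover have "2 * b\<^sup>2 \<le> b" using b mult_left_mono[of b "1 / 2" b] by (simp add: power2_eq_square)
    ultimately have "exp (- (2 * b)) \<le> exp (ln (1 - b))" by simp
    then have "exp (- (2 * b)) ^ t \<le> (1 - b) ^ t" using b by (intro power_mono) auto
    moreover have "exp (- (2 * b)) ^ t = exp (- l / 8)"
      using t unfolding exp_of_nat_mult[symmetric] b_def by simp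
    ultimately show ?thesis by simp
  qed
  have t_m: "t \<le> m"
  proof -
    have "2 \<le> exp l" using exp_ge_add_one_self[of l] l by linarith
    then have "\<delta> \<le> 1 / 2" unfolding \<delta>_l by (simp add: exp_minus field_simps)
    then have "real n * (1 / 2) \<le> real n * (1 - \<delta>)" by (intro mult_left_mono) auto
    then have "real t \<le> real m" using t(3) unfolding m by linarith
    then show ?thesis by simp
  qed
  have m_n: "m \<le> n"
  proof -
    have "0 \<le> real n * exp (- l)" by simp
    then show ?thesis using gap by linarith
  qed
  \<comment> \<open>Since \<open>n * exp (- l) = x * exp (- 3 * l / 4)\<close> and
    \<open>x \<le> t\<close>, the exponent splits into \<open>- l / 8\<close>, which pays for
    \<open>(1 - b) ^ t\<close>, and \<open>- 5 * l / 8\<close>, which pays for the factor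
    1/4.\<close>
  have gap_t: "real n - real m \<le> t * (1 - b) ^ t / 4"
  proof -
    have "real n * exp (- l) = x * exp (- (3 * l / 4))" unfolding x_def by (simp flip: exp_add)
    also have "\<dots> \<le> real t * exp (- (3 * l / 4))" using t by simp
    also have "exp (- (3 * l / 4)) = exp (- l / 8) * exp (- (5 * l / 8))" by (simp flip: exp_add)
    also have "exp (- (5 * l / 8)) \<le> 1 / 4"
      using exp_ge_add_one_self[of "5 * l / 8"] l by (simp add: exp_minus field_simps)
    also have "exp (- l / 8) \<le> (1 - b) ^ t" by (rule pow_ge)
    finally show ?thesis unfolding gap by (simp add: mult_left_mono)
  qed
  have "\<P>(\<omega> in runs m D R. \<forall>i\<in>{1..m}. probe_complexity A i \<omega> \<le> c)
      \<le> 16 * (real c)\<^sup>2 / (t * (1 - b) ^ (2 * t))"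
  proof (rule prob_all_probe_complexity_le)
    show "card {s\<in>{1..n}. b \<le> ?q s} \<le> t / 2" using i(2) unfolding b_def t_def by simp
  qed (use t t_m m_n b gap_t in auto)
  also have "\<dots> \<le> 16 * (real c)\<^sup>2 / exp (l / 2)"
  proof (rule divide_left_mono)
    have "exp (l / 2) = exp (3 * l / 4) * (exp (- l / 8))\<^sup>2"
      by (simp add: power2_eq_square flip: exp_add)
    also have "\<dots> \<le> t * ((1 - b) ^ t)\<^sup>2"
      using t_ge pow_ge by (intro mult_mono power_mono) auto
    finally show "exp (l / 2) \<le> t * (1 - b) ^ (2 * t)" by (simp add: power_even_eq)
    show "0 < t * (1 - b) ^ (2 * t) * exp (l / 2)" using t b by simp
  qed simp
  also have "\<dots> \<le> 1 / 4"
  proof -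
    \<comment> \<open>The fourth power matches the growth of \<open>c ^ 2\<close>, which is at most
      \<open>l ^ 4 / 2 ^ 20\<close>.\<close>
    have "(l / 8) ^ 4 \<le> exp (l / 8) ^ 4"
    proof (rule power_mono)
      show "l / 8 \<le> exp (l / 8)" using exp_ge_add_one_self[of "l / 8"] by linarith
    qed (use l in simp)
    also have "\<dots> = exp (l / 2)" unfolding exp_of_nat_mult[symmetric] by simp
    finally have "l ^ 4 / 4096 \<le> exp (l / 2)" by (simp add: power_divide)
    moreover have "(real c)\<^sup>2 \<le> (l\<^sup>2 / 1024)\<^sup>2" using c by (intro power_mono) auto
    then have "(real c)\<^sup>2 \<le> l ^ 4 / 1048576" by (simp add: power_divide flip: power_mult)
    moreover have "0 \<le> exp (l / 2)" by simp
    ultimately have "16 * (real c)\<^sup>2 \<le> 1 / 4 * exp (l / 2)" by linarith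
    then show ?thesis by (simp add: divide_le_eq)
  qed
  finally show ?thesis by simp
qed

text \<open>The constant 1/4096 converts base 2 to natural logarithms:
  \<open>ln 2 \<ge> 1 / 2\<close> gives \<open>L \<le> l ^ 2 / 1024\<close>. For
  \<open>l < 16\<close> this is at most 1, and every key qualifies almost surely because probe
  indices start at 1. Otherwise the previous lemma is applied to the integer part of
  \<open>L\<close>.\<close>

lemma prob_exists_large_probe_complexity:
  assumes \<delta>: "0 < \<delta>" "\<delta> < 1" and m: "real m = real n * (1 - \<delta>)"
  shows "1 / 2 < \<P>(\<omega> in runs m D R. \<exists>i\<in>{1..m}. 1 / 4096 * (log 2 (1 / \<delta>))\<^sup>2 \<le> real (probe_complexity A i \<omega>))"
    (is "1 / 2 < measure _ ?large")
proof -
  interpret P: prob_space "runs m D R" unfolding runs_def by (rule prob_space_seed_keys)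
  have n: "0 < n"
  proof (rule ccontr)
    assume "\<not> 0 < n"
    \<comment> \<open>With no slots there are no probe sequences, so \<open>D\<close> could not be a
      probability measure.\<close>
    then have "space D = {}" unfolding space_D by (auto simp: PiE_eq_empty_iff)
    then show False using prob_space.not_empty[OF prob_space_D] by simp
  qed
  have m_pos: "1 \<le> m"
  proof -
    have "0 < real m" unfolding m using n \<delta> by simp
    then show ?thesis by simp
  qed
  define l where "l = ln (1 / \<delta>)"
  have l: "0 < l" unfolding l_def using \<delta> by simp
  define L where "L = 1 / 4096 * (log 2 (1 / \<delta>))\<^sup>2"
  have L0: "0 \<le> L" unfolding L_def by simp
  have L: "L \<le> l\<^sup>2 / 1024"
  proof -
    have "1 / 2 \<le> ln (2::real)" using exp_half_le2 by (subst ln_ge_iff) simp_all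
    then have "l / ln 2 \<le> 2 * l" using l by (simp add: field_simps)
    then have "(l / ln 2)\<^sup>2 \<le> (2 * l)\<^sup>2" using l by (intro power_mono) auto
    then show ?thesis unfolding L_def l_def log_def by (simp add: power_mult_distrib)
  qed
  have event: "{\<omega>\<in>space (runs m D R). Q (probe_complexity A i \<omega>)} \<in> P.events" if "i \<in> {1..m}" for i Q
  proof -
    have "probe_complexity A i \<in> runs m D R \<rightarrow>\<^sub>M count_space UNIV"
      unfolding runs_def using that by (intro measurable_probe_complexity) auto
    from measurable_sets[OF this, of "{y. Q y}"] show ?thesis
      by (simp add: vimage_def Int_def conj_commute)
  qed
  have large: "?large \<in> P.events"
    by (intro sets.sets_Collect_finite_Ex event) auto
  show ?thesis
  proof (cases "16 \<le> l")
    case False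
    then have "l\<^sup>2 \<le> 16\<^sup>2" using l by (intro power_mono) auto
    then have "L \<le> 1" using L by simp
    have "AE \<omega> in runs m D R. \<omega> \<in> ?large"
      using placed AE_space
    proof eventually_elim
      case (elim \<omega>)
      then have "1 \<le> probe_complexity A 1 \<omega>" using m_pos by simp
      then have "L \<le> real (probe_complexity A 1 \<omega>)" using \<open>L \<le> 1\<close> by simp
      then show ?case using elim m_pos unfolding L_def by force
    qed
    moreover note large
    ultimately have "P.prob ?large = 1" by (simp add: P.prob_eq_1)
    then show ?thesis by simp
  next
    case True
    define c where "c = nat \<lfloor>L\<rfloor>"
    have "real c \<le> l\<^sup>2 / 1024" unfolding c_def using L L0 by linarith
    have "1 - P.prob ?large \<le> P.prob {\<omega>\<in>space (runs m D R). \<forall>i\<in>{1..m}. probe_complexity A i \<omega> \<le> c}"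
    proof -
      have "{\<omega>\<in>space (runs m D R). \<forall>i\<in>{1..m}. probe_complexity A i \<omega> \<le> c} \<in> P.events"
        by (intro sets.sets_Collect_finite_All event) auto
      moreover have "y \<le> c" if "\<not> L \<le> real y" for y
        using that unfolding c_def by linarith
      then have "space (runs m D R) - ?large
          \<subseteq> {\<omega>\<in>space (runs m D R). \<forall>i\<in>{1..m}. probe_complexity A i \<omega> \<le> c}"
        unfolding L_def by auto
      ultimately show ?thesis
        unfolding P.prob_compl[OF large, symmetric] by (intro P.finite_measure_mono)
    qed
    also have "\<dots> < 1 / 2"
      by (rule prob_all_probe_complexity_less_half[OF \<delta> m n l_def True]) fact
    finally show ?thesis by simp
  qed
qed

end

text \<open>The constant in the first conjunct is uniform in all parameters. The second conjunct
  follows by complementation; leaving the filter arbitrary covers every way of letting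
  \<open>n\<close> and \<delta> vary.\<close>

theorem theorem6:
  "(\<exists>C>0. \<forall>n m \<delta> D R A.
      0 < \<delta> \<and> \<delta> < 1 \<and> real m = real n * (1 - \<delta>) \<and> open_addressing n m D R A \<longrightarrow>
      \<P>(\<omega> in runs m D R. \<exists>i\<in>{1..m}. real (probe_complexity A i \<omega>) \<ge> C * (log 2 (1 / \<delta>))\<^sup>2) > 1 / 2)
   \<and>
   (\<forall>(F :: (nat \<times> real) filter) c.
      c \<in> o[F](\<lambda>(n, \<delta>). (log 2 (1 / \<delta>))\<^sup>2) \<longrightarrow>
      (\<forall>\<^sub>F (n, \<delta>) in F. \<forall>m D R A.
         0 < \<delta> \<and> \<delta> < 1 \<and> real m = real n * (1 - \<delta>) \<and> open_addressing n m D R A \<longrightarrow>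
         \<P>(\<omega> in runs m D R. \<forall>i\<in>{1..m}. real (probe_complexity A i \<omega>) \<le> c (n, \<delta>)) \<le> 1 / 2))"
proof (intro conjI allI impI)
  show "\<exists>C>0. \<forall>n m \<delta> D R A.
      0 < \<delta> \<and> \<delta> < 1 \<and> real m = real n * (1 - \<delta>) \<and> open_addressing n m D R A \<longrightarrow>
      \<P>(\<omega> in runs m D R. \<exists>i\<in>{1..m}. real (probe_complexity A i \<omega>) \<ge> C * (log 2 (1 / \<delta>))\<^sup>2) > 1 / 2"
    using open_addressing.prob_exists_large_probe_complexity
    by (intro exI[of _ "1 / 4096"] conjI allI impI) auto
next
  fix F :: "(nat \<times> real) filter" and c
  assume "c \<in> o[F](\<lambda>(n, \<delta>). (log 2 (1 / \<delta>))\<^sup>2)"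
  \<comment> \<open>Half of 1/4096 is taken so that \<open>c (n, \<delta>)\<close> is strictly below
    \<open>L\<close>, the squared logarithm being positive.\<close>
  then have "\<forall>\<^sub>F x in F. norm (c x) \<le> 1 / 8192 * norm (case x of (n, \<delta>) \<Rightarrow> (log 2 (1 / \<delta>))\<^sup>2)"
    by (rule landau_o.smallD) simp
  then show "\<forall>\<^sub>F (n, \<delta>) in F. \<forall>m D R A.
      0 < \<delta> \<and> \<delta> < 1 \<and> real m = real n * (1 - \<delta>) \<and> open_addressing n m D R A \<longrightarrow>
      \<P>(\<omega> in runs m D R. \<forall>i\<in>{1..m}. real (probe_complexity A i \<omega>) \<le> c (n, \<delta>)) \<le> 1 / 2"
  proof (rule eventually_mono, clarify)
    fix n \<delta> m D R A
    assume small: "norm (c (n, \<delta>)) \<le> 1 / 8192 * norm ((log 2 (1 / \<delta>))\<^sup>2)"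
      and \<delta>: "0 < \<delta>" "\<delta> < (1::real)" and m: "real m = real n * (1 - \<delta>)"
      and "open_addressing n m D R A"
    interpret open_addressing n m D R A by fact
    interpret P: prob_space "runs m D R" unfolding runs_def by (rule prob_space_seed_keys)
    define L where "L = 1 / 4096 * (log 2 (1 / \<delta>))\<^sup>2"
    let ?large = "{\<omega>\<in>space (runs m D R). \<exists>i\<in>{1..m}. L \<le> real (probe_complexity A i \<omega>)}"
    have "0 < log 2 (1 / \<delta>)" using \<delta> by simp
    then have "0 < (log 2 (1 / \<delta>))\<^sup>2" by (rule zero_less_power)
    then have "c (n, \<delta>) < L" using small unfolding L_def real_norm_def abs_power2 by linarith
    have large: "1 / 2 < P.prob ?large"
      unfolding L_def by (rule prob_exists_large_probe_complexity[OF \<delta> m])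
    \<comment> \<open>Sets outside the sigma-algebra have measure 0 by convention, so a positive
      value certifies measurability.\<close>
    then have ev: "?large \<in> P.events"
      using measure_notin_sets by fastforce
    have "P.prob {\<omega>\<in>space (runs m D R). \<forall>i\<in>{1..m}. real (probe_complexity A i \<omega>) \<le> c (n, \<delta>)}
        \<le> P.prob (space (runs m D R) - ?large)"
      using ev \<open>c (n, \<delta>) < L\<close> by (intro P.finite_measure_mono) force+
    also have "\<dots> \<le> 1 / 2" using large P.prob_compl[OF ev] by simp
    finally show "P.prob {\<omega>\<in>space (runs m D R). \<forall>i\<in>{1..m}. real (probe_complexity A i \<omega>) \<le> c (n, \<delta>)} \<le> 1 / 2" .
  qed
qed

end
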